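(* The first order differential operators $$\mathcal{D}=\partial_x x+x(A-1),\qquad \mathcal{D}^\dagger=-\partial_x x-(1+\nu+J)+x\phi'(x)-x$$ are mutually adjoint with respect to $W^{(\nu)}_\phi$, that is, $\langle P\cdot\mathcal{D},Q\rangle=\langle P,Q\cdot\mathcal{D}^\dagger\rangle$ for all matrix polynomials $P,Q\in M_N(\mathbb{C})[x]$.
   Context: Let $N\ge1$, $\nu>0$, let $a_1,\dots,a_{N-1}$ be real, let $E_{i,j}$ be the matrix units, and put $J=\sum_{k=1}^N kE_{k,k}$, $A=\sum_{k=1}^{N-1}a_kE_{k+1,k}$. Let $\phi$ be analytic on a neighbourhood of $[0,\infty)$, real valued on $[0,\infty)$, let $\delta^{(\nu)}_1,\dots,\delta_N^{(\nu)}>0$, and $$W^{(\nu)}_\phi(x)=e^{Ax}\,T^{(\nu)}_\phi(x)\,e^{A^*x},\qquad T^{(\nu)}_\phi(x)=e^{-\phi(x)}\sum_{k=1}^N\delta_k^{(\nu)}x^{\nu+k}E_{k,k},\qquad x\in[0,\infty).$$ It is assumed that $W^{(\nu)}_\phi$ has finite moments of all orders and that $W^{(\nu)}_\phi(x)P(x)$ tends to $0$ at the endpoints $x\to0$ and $x\to\infty$ for every matrix polynomial $P$. The matrix valued inner product is $\langle P,Q\rangle=\int_0^\infty P(x)W^{(\nu)}_\phi(x)Q(x)^*\,dx$. Differential operators act from the right: $P\cdot\sum_j\partial_x^jF_j(x)=\sum_jP^{(j)}(x)F_j(x)$; scalars denote multiples of the identity matrix. *)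

theory Defs
  imports "HOL-Analysis.Analysis" "HOL-Computational_Algebra.Polynomial"
begin

text \<open>
  Matrices of size \<open>N\<close> are indexed by a finite linearly ordered type with
  \<open>N = CARD('n)\<close> elements; \<open>pos\<close> numbers the indices by \<open>1, \<dots>, N\<close>.
  On \<open>'n cmat\<close> the product is \<open>**\<close>, and \<open>mat c\<close> is the scalar \<open>c\<close>
  regarded as a multiple of the identity matrix.
\<close>

type_synonym 'n cmat = "((complex, 'n) vec, 'n) vec"
type_synonym 'n mpoly = "((complex poly, 'n) vec, 'n) vec"

definition pos :: "'n::{finite,linorder} \<Rightarrow> nat" where
  "pos i = card {..i}"

definition matrix_unit :: "nat \<Rightarrow> nat \<Rightarrow> 'n::{finite,linorder} cmat" where
  "matrix_unit k l = (\<chi> i j. if pos i = k \<and> pos j = l then 1 else 0)"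

definition matJ :: "'n::{finite,linorder} cmat" where
  "matJ = (\<Sum>k = 1..CARD('n). real k *\<^sub>R matrix_unit k k)"

definition matA :: "(nat \<Rightarrow> real) \<Rightarrow> 'n::{finite,linorder} cmat" where
  "matA a = (\<Sum>k = 1..CARD('n) - 1. a k *\<^sub>R matrix_unit (k + 1) k)"

definition adj :: "'n::finite cmat \<Rightarrow> 'n cmat" where
  "adj M = (\<chi> i j. cnj (M $ j $ i))"

text \<open>The library's \<open>exp\<close> and power do not apply here: the type class product on
  \<open>'n cmat\<close> is entrywise.\<close>

definition mat_exp :: "'n::finite cmat \<Rightarrow> 'n cmat" where
  "mat_exp M = (\<Sum>k. (1 / fact k) *\<^sub>R (((**) M) ^^ k) (mat 1))"

text \<open>\<open>\<phi>\<close> has complex arguments and values, so that analyticity on a neighbourhood of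
  \<open>[0,\<infinity>)\<close> is \<open>analytic_on\<close> and \<open>\<phi>'\<close> is \<open>deriv \<phi>\<close>; it is evaluated at real points only.\<close>

definition weightT ::
    "real \<Rightarrow> (nat \<Rightarrow> real) \<Rightarrow> (complex \<Rightarrow> complex) \<Rightarrow> real \<Rightarrow> 'n::{finite,linorder} cmat" where
  "weightT \<nu> \<delta> \<phi> x = mat (exp (- \<phi> (of_real x))) **
     (\<Sum>k = 1..CARD('n). (\<delta> k * x powr (\<nu> + real k)) *\<^sub>R matrix_unit k k)"

definition weightW ::
    "real \<Rightarrow> (nat \<Rightarrow> real) \<Rightarrow> (nat \<Rightarrow> real) \<Rightarrow> (complex \<Rightarrow> complex) \<Rightarrow> real \<Rightarrow>
       'n::{finite,linorder} cmat" where
  "weightW \<nu> a \<delta> \<phi> x =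
     mat_exp (x *\<^sub>R matA a) ** weightT \<nu> \<delta> \<phi> x ** mat_exp (x *\<^sub>R adj (matA a))"

text \<open>Matrix polynomials are matrices with polynomial entries.\<close>

definition mpoly_eval :: "'n::finite mpoly \<Rightarrow> real \<Rightarrow> 'n cmat" where
  "mpoly_eval P x = (\<chi> i j. poly (P $ i $ j) (of_real x))"

definition mpoly_deriv :: "'n::finite mpoly \<Rightarrow> 'n mpoly" where
  "mpoly_deriv P = (\<chi> i j. pderiv (P $ i $ j))"

text \<open>The list \<open>[F\<^sub>0, F\<^sub>1, \<dots>]\<close> stands for the operator \<open>\<Sum>j. \<partial>\<^sup>j F\<^sub>j(x)\<close>.  As its
  coefficients need not be polynomial, it maps matrix polynomials to matrix valued functions.\<close>

definition diff_op_act ::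
    "'n::finite mpoly \<Rightarrow> (real \<Rightarrow> 'n cmat) list \<Rightarrow> real \<Rightarrow> 'n cmat" where
  "diff_op_act P Fs x = (\<Sum>j<length Fs. mpoly_eval ((mpoly_deriv ^^ j) P) x ** (Fs ! j) x)"

definition opD :: "(nat \<Rightarrow> real) \<Rightarrow> (real \<Rightarrow> 'n::{finite,linorder} cmat) list" where
  "opD a = [\<lambda>x. x *\<^sub>R (matA a - mat 1), \<lambda>x. mat (of_real x)]"

definition opD_dagger ::
    "real \<Rightarrow> (complex \<Rightarrow> complex) \<Rightarrow> (real \<Rightarrow> 'n::{finite,linorder} cmat) list" where
  "opD_dagger \<nu> \<phi> =
     [\<lambda>x. - (mat (of_real (1 + \<nu>)) + matJ) + mat (of_real x * deriv \<phi> (of_real x)) - mat (of_real x),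
      \<lambda>x. - mat (of_real x)]"

text \<open>
  The integral is the Henstock-Kurzweil integral, so it includes conditionally convergent
  improper integrals.  This matters because \<open>\<phi>'\<close> may oscillate so strongly at infinity that
  \<open>x \<phi>'(x) W(x)\<close> fails to be absolutely integrable.
\<close>

definition inner_integrand ::
    "(real \<Rightarrow> 'n::finite cmat) \<Rightarrow> (real \<Rightarrow> 'n cmat) \<Rightarrow> (real \<Rightarrow> 'n cmat) \<Rightarrow>
       real \<Rightarrow> 'n cmat" where
  "inner_integrand W F G x = F x ** W x ** adj (G x)"

definition mat_inner ::
    "(real \<Rightarrow> 'n::finite cmat) \<Rightarrow> (real \<Rightarrow> 'n cmat) \<Rightarrow> (real \<Rightarrow> 'n cmat) \<Rightarrow>
       'n cmat" where
  "mat_inner W F G = integral {0..} (inner_integrand W F G)"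

end

theory Submission
  imports Defs
begin

text \<open>
  The adjointness is integration by parts for the boundary form \<open>x P(x) W(x) Q(x)\<^sup>*\<close>.  Write
  \<open>K(x) = J + \<nu> - x \<phi>'(x)\<close> (\<open>pearson_coeff\<close> below).  The weight satisfies the
  Pearson equation \<open>x W' = x A W + W K\<close> on \<open>(0,\<infinity>)\<close> (\<open>weightW_pearson\<close>).  In terms
  of \<open>K\<close> the operator \<open>D\<^sup>\<dagger>\<close> sends \<open>Q\<close> to \<open>-(Q K + (1 + x) Q + x Q')\<close>, so the product rule gives
  \<open>(x P W Q\<^sup>*)' = (P \<cdot> D) W Q\<^sup>* - P W (Q \<cdot> D\<^sup>\<dagger>)\<^sup>*\<close>
  (\<open>has_vector_derivative_boundary_form\<close>), and the boundary form vanishes at \<open>0\<close> and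
  at \<open>\<infinity>\<close>.

  The Pearson equation needs two facts.  First, \<open>x T' = T K\<close>, since the entries of \<open>T\<close> are
  multiples of \<open>e\<^sup>-\<^sup>\<phi> x\<^sup>\<nu>\<^sup>+\<^sup>k\<close>.  Second, \<open>J\<close> grades the matrices by the distance to the diagonal, and
  \<open>A\<^sup>k\<close> lives on the \<open>k\<close>-th subdiagonal; hence \<open>[J, A\<^sup>k] = k A\<^sup>k\<close> and \<open>[J, e\<^sup>x\<^sup>A] = x A e\<^sup>x\<^sup>A\<close>.  The
  adjoint of this commutator identity moves \<open>K\<close> across \<open>e\<close> to the power \<open>x A\<^sup>*\<close> and absorbs
  the derivative of that factor.

  Only the integrand of \<open>\<langle>P \<cdot> D, Q\<rangle>\<close> is a polynomial combination of the integrable functions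
  \<open>x\<^sup>m W\<close>.  The other integrand involves \<open>\<phi>'\<close>, and its integrability is a conclusion: it differs
  from the first one by the derivative of the boundary form, which has an improper
  Henstock-Kurzweil integral equal to the difference of the boundary values
  (\<open>has_integral_improper_FTC\<close>).
\<close>

section \<open>The fundamental theorem of calculus on a half-line\<close>

text \<open>
  A Henstock-Kurzweil integral over \<open>[c,\<infinity>)\<close> is by definition a limit of integrals over \<open>[c,b]\<close>,
  and these equal \<open>F b - F c\<close>; so the integral exists even where it converges only conditionally.
\<close>

lemma has_integral_improper_FTC:
  fixes F :: "real \<Rightarrow> 'a::banach"
  assumes cont: "continuous_on {c..} F"
    and deriv: "\<And>x. x > c \<Longrightarrow> (F has_vector_derivative f x) (at x)"
    and lim: "(F \<longlongrightarrow> l) at_top"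
  shows "(f has_integral (l - F c)) {c..}"
proof (subst has_integral', intro allI impI)
  fix e :: real
  assume "e > 0"
  then have "eventually (\<lambda>x. dist (F x) l < e) at_top"
    using lim by (simp add: tendsto_iff)
  then obtain B where B: "\<And>x. x \<ge> B \<Longrightarrow> dist (F x) l < e"
    by (auto simp: eventually_at_top_linorder)
  \<comment> \<open>A box around the ball of this radius contains \<open>c\<close> and ends beyond \<open>B\<close>.\<close>
  define B' where "B' = max (max B 1) (\<bar>c\<bar> + 1)"
  have "\<exists>z. ((\<lambda>x. if x \<in> {c..} then f x else 0) has_integral z) (cbox a b) \<and>
            norm (z - (l - F c)) < e" if sub: "ball 0 B' \<subseteq> cbox a b" for a b
  proof -
    have "B' > 0" by (simp add: B'_def)
    with sub have ab: "a \<le> - B'" "B' \<le> b"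
      by (simp_all add: ball_eq_greaterThanLessThan greaterThanLessThan_subseteq_atLeastAtMost_iff)
    then have "a \<le> c" "c \<le> b" "B \<le> b" unfolding B'_def by linarith+
    have "(f has_integral (F b - F c)) {c..b}"
      using \<open>c \<le> b\<close> cont deriv
      by (intro fundamental_theorem_of_calculus_interior) (auto elim: continuous_on_subset)
    then have "((\<lambda>x. if x \<in> {c..b} then f x else 0) has_integral (F b - F c)) (cbox a b)"
      using \<open>a \<le> c\<close> by (subst has_integral_restrict) auto
    then have "((\<lambda>x. if x \<in> {c..} then f x else 0) has_integral (F b - F c)) (cbox a b)"
      by (rule has_integral_eq[rotated]) auto
    moreover have "norm (F b - F c - (l - F c)) < e"
      using B[OF \<open>B \<le> b\<close>] by (simp add: dist_norm)
    ultimately show ?thesis by blast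
  qed
  moreover have "B' > 0" by (simp add: B'_def)
  ultimately show "\<exists>B>0. \<forall>a b. ball 0 B \<subseteq> cbox a b \<longrightarrow>
      (\<exists>z. ((\<lambda>x. if x \<in> {c..} then f x else 0) has_integral z) (cbox a b) \<and>
           norm (z - (l - F c)) < e)"
    by blast
qed

section \<open>Matrix calculus\<close>

lemma has_vector_derivative_vec:
  fixes f :: "real \<Rightarrow> ('a::real_normed_vector, 'n::finite) vec"
  assumes "\<And>i. ((\<lambda>t. f t $ i) has_vector_derivative f' $ i) (at x)"
  shows "(f has_vector_derivative f') (at x)"
  using assms unfolding has_vector_derivative_def has_derivative_at_within
  by (auto intro!: vec_tendstoI bounded_linear_scaleR_left)

lemma has_vector_derivative_mat:
  fixes f :: "real \<Rightarrow> 'n::finite cmat"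
  assumes "\<And>i j. ((\<lambda>t. f t $ i $ j) has_vector_derivative f' $ i $ j) (at x)"
  shows "(f has_vector_derivative f') (at x)"
  by (intro has_vector_derivative_vec assms)

lemma bounded_bilinear_matrix_mult:
  "bounded_bilinear ((**) :: 'n::finite cmat \<Rightarrow> 'n cmat \<Rightarrow> 'n cmat)"
  unfolding bilinear_conv_bounded_bilinear[symmetric] bilinear_def
  by (auto intro!: linearI simp: matrix_matrix_mult_def vec_eq_iff sum.distrib algebra_simps
      scaleR_sum_right)

interpretation mm: bounded_bilinear "(**) :: 'n::finite cmat \<Rightarrow> 'n cmat \<Rightarrow> 'n cmat"
  by (rule bounded_bilinear_matrix_mult)

lemma bounded_linear_adj: "bounded_linear (adj :: 'n::finite cmat \<Rightarrow> 'n cmat)"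
  by (intro linear_conv_bounded_linear[THEN iffD1] linearI) (simp_all add: adj_def vec_eq_iff)

lemmas adj_minus = linear_neg[OF bounded_linear.linear[OF bounded_linear_adj]]
  and adj_zero = linear_0[OF bounded_linear.linear[OF bounded_linear_adj]]
  and adj_add = linear_add[OF bounded_linear.linear[OF bounded_linear_adj]]
  and adj_scaleR = linear_scale[OF bounded_linear.linear[OF bounded_linear_adj]]
  and adj_sum = linear_sum[OF bounded_linear.linear[OF bounded_linear_adj]]

lemma adj_mult: "adj (M ** L) = adj L ** adj M"
  by (simp add: adj_def matrix_matrix_mult_def vec_eq_iff mult.commute)

lemma adj_mat: "adj (mat c) = mat (cnj c)"
  by (simp add: adj_def mat_def vec_eq_iff)

lemma mat_of_real: "mat (complex_of_real c) = c *\<^sub>R (mat 1 :: 'n::finite cmat)"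
  by (simp add: mat_def vec_eq_iff scaleR_conv_of_real[where 'a = complex])

definition diag_mat :: "('n::finite \<Rightarrow> complex) \<Rightarrow> 'n cmat" where
  "diag_mat d = (\<chi> i j. if i = j then d i else 0)"

lemma diag_mat_nth [simp]: "diag_mat d $ i $ j = (if i = j then d i else 0)"
  by (simp add: diag_mat_def)

lemma diag_mat_mult_nth: "(diag_mat d ** M) $ i $ j = d i * M $ i $ j"
  by (simp add: matrix_matrix_mult_def if_distrib[of "\<lambda>z. z * _"] cong: if_cong)

lemma mult_diag_mat_nth: "(M ** diag_mat d) $ i $ j = M $ i $ j * d j"
  by (simp add: matrix_matrix_mult_def if_distrib[of "\<lambda>z. _ * z"] cong: if_cong)

abbreviation mpow :: "'n::finite cmat \<Rightarrow> nat \<Rightarrow> 'n cmat" where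
  "mpow M k \<equiv> (((**) M) ^^ k) (mat 1)"

lemma mpow_Suc: "mpow M (Suc k) = M ** mpow M k"
  by simp

lemma mpow_Suc_right: "mpow M (Suc k) = mpow M k ** M"
  by (induction k) (auto simp: matrix_mul_assoc)

lemma mpow_scaleR: "mpow (x *\<^sub>R M) k = (x ^ k) *\<^sub>R mpow M k"
  by (induction k) (simp_all add: mm.scaleR_left mm.scaleR_right)

lemma adj_mpow: "adj (mpow M k) = mpow (adj M) k"
  by (induction k) (simp_all add: adj_mat adj_mult mpow_Suc_right[simplified])

lemma mpow_eq_0_mono:
  assumes "mpow M K = 0" "K \<le> k" shows "mpow M k = 0"
  using assms(2) by (induction k rule: dec_induct) (simp_all add: assms(1))

section \<open>The exponential of a nilpotent matrix\<close>

lemma mat_exp_nilpotent: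
  assumes "mpow M K = 0"
  shows "mat_exp (x *\<^sub>R M) = (\<Sum>k<K. (x ^ k / fact k) *\<^sub>R mpow M k)"
proof -
  have "mat_exp (x *\<^sub>R M) = (\<Sum>k. (x ^ k / fact k) *\<^sub>R mpow M k)"
    by (simp add: mat_exp_def mpow_scaleR)
  also have "\<dots> = (\<Sum>k<K. (x ^ k / fact k) *\<^sub>R mpow M k)"
    by (intro suminf_finite) (auto simp: mpow_eq_0_mono[OF assms])
  finally show ?thesis .
qed

lemma adj_mat_exp_nilpotent:
  assumes "mpow M K = 0"
  shows "adj (mat_exp (x *\<^sub>R M)) = mat_exp (x *\<^sub>R adj M)"
proof -
  have "mpow (adj M) K = 0"
    by (metis adj_mpow assms adj_zero)
  from mat_exp_nilpotent[OF this] show ?thesis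
    by (simp add: mat_exp_nilpotent[OF assms] adj_sum adj_scaleR adj_mpow)
qed

lemma has_vector_derivative_mat_exp_nilpotent:
  assumes "mpow M K = 0"
  shows "((\<lambda>x. mat_exp (x *\<^sub>R M)) has_vector_derivative M ** mat_exp (x *\<^sub>R M)) (at x)"
proof -
  \<comment> \<open>Differentiation shortens the sum by one term; the extra zero term keeps its length at \<open>K\<close>.\<close>
  have K: "mpow M (Suc K) = 0" using assms by simp
  have "((\<lambda>x. \<Sum>k<Suc K. (x ^ k / fact k) *\<^sub>R mpow M k) has_vector_derivative
      (\<Sum>k<Suc K. (real k * x ^ (k - 1) / fact k) *\<^sub>R mpow M k)) (at x)"
    by (auto intro!: derivative_eq_intros simp: mult_ac)
  also have "(\<Sum>k<Suc K. (real k * x ^ (k - 1) / fact k) *\<^sub>R mpow M k) =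
      (\<Sum>k<K. (x ^ k / fact k) *\<^sub>R mpow M (Suc k))"
    by (subst sum.lessThan_Suc_shift) (auto intro!: sum.cong simp del: of_nat_Suc)
  also have "\<dots> = M ** mat_exp (x *\<^sub>R M)"
    by (simp add: mat_exp_nilpotent[OF assms] mm.sum_right mm.scaleR_right)
  finally show ?thesis
    unfolding mat_exp_nilpotent[OF K] .
qed

section \<open>The grading by the diagonal matrix of positions\<close>

lemma pos_eq_iff: "pos i = pos j \<longleftrightarrow> i = j"
proof
  assume e: "pos i = pos j"
  show "i = j"
  proof (rule ccontr)
    assume "i \<noteq> j"
    then have "{..i} \<subset> {..j} \<or> {..j} \<subset> {..i}"
      by (metis atMost_subset_iff linorder_le_cases psubsetI atMost_eq_iff)
    then show False
      using e psubset_card_mono[of "{..i}" "{..j}"] psubset_card_mono[of "{..j}" "{..i}"]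
      by (auto simp: pos_def)
  qed
qed simp

lemma pos_bounds: "1 \<le> pos i" "pos (i :: 'n::{finite,linorder}) \<le> CARD('n)"
  by (auto simp: pos_def card_gt_0_iff Suc_le_eq intro: card_mono)

lemma matJ_diag: "matJ = (diag_mat (\<lambda>i. of_nat (pos i)) :: 'n::{finite,linorder} cmat)"
proof -
  have "(matJ :: 'n cmat) $ i $ j = diag_mat (\<lambda>i. of_nat (pos i)) $ i $ j" for i j
  proof -
    have "(matJ :: 'n cmat) $ i $ j =
        (\<Sum>k = 1..CARD('n). if pos i = k then (if i = j then of_nat (pos i) else 0) else 0)"
      unfolding matJ_def sum_component
      by (intro sum.cong)
        (auto simp: matrix_unit_def pos_eq_iff scaleR_conv_of_real[where 'a = complex])
    also have "\<dots> = diag_mat (\<lambda>i. of_nat (pos i)) $ i $ j"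
      using pos_bounds[of i] by simp
    finally show ?thesis .
  qed
  then show ?thesis by (simp add: vec_eq_iff)
qed

lemma matA_nth_nonzero:
  assumes "matA a $ i $ j \<noteq> 0" shows "pos i = Suc (pos j)"
proof (rule ccontr)
  assume "pos i \<noteq> Suc (pos j)"
  then have "matA a $ i $ j = 0"
    by (auto simp: matA_def matrix_unit_def intro!: sum.neutral)
  with assms show False by simp
qed

text \<open>
  Each factor \<open>A\<close> raises the position by one, so \<open>A\<^sup>k\<close> is supported on the \<open>k\<close>-th subdiagonal.
  Both the nilpotency of \<open>A\<close> and the commutation relation with \<open>J\<close> follow from this.
\<close>

lemma mpow_matA_nth_nonzero:
  "mpow (matA a) k $ i $ j \<noteq> 0 \<Longrightarrow> pos i = pos j + k"
proof (induction k arbitrary: i)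
  case 0
  then show ?case by (auto simp: mat_def split: if_splits)
next
  case (Suc k)
  from Suc.prems have "(\<Sum>l\<in>UNIV. matA a $ i $ l * mpow (matA a) k $ l $ j) \<noteq> 0"
    unfolding mpow_Suc by (simp add: matrix_matrix_mult_def del: funpow.simps)
  then obtain l where "matA a $ i $ l * mpow (matA a) k $ l $ j \<noteq> 0"
    by (meson sum.not_neutral_contains_not_neutral)
  then have "matA a $ i $ l \<noteq> 0" "mpow (matA a) k $ l $ j \<noteq> 0" by auto
  then show ?case using Suc.IH matA_nth_nonzero by fastforce
qed

lemma matA_nilpotent: "mpow (matA a :: 'n::{finite,linorder} cmat) CARD('n) = 0"
proof -
  have "mpow (matA a :: 'n cmat) CARD('n) $ i $ j = 0" for i j
    using mpow_matA_nth_nonzero[of "CARD('n)" a i j] pos_bounds(2)[of i] pos_bounds(1)[of j]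
    by fastforce
  then show ?thesis by (simp add: vec_eq_iff)
qed

text \<open>
  The \<open>(i,j)\<close> entry of a commutator with \<open>J\<close> is multiplied by \<open>pos i - pos j\<close>, which is \<open>k\<close> wherever
  \<open>A\<^sup>k\<close> is nonzero.
\<close>

lemma matJ_mpow_matA:
  "matJ ** mpow (matA a) k = mpow (matA a) k ** matJ + real k *\<^sub>R mpow (matA a) k"
proof -
  have "of_nat (pos i) * mpow (matA a) k $ i $ j =
      mpow (matA a) k $ i $ j * of_nat (pos j) + real k *\<^sub>R mpow (matA a) k $ i $ j"
    for i j :: 'a
    using mpow_matA_nth_nonzero[of k a i j]
    by (cases "mpow (matA a) k $ i $ j = 0")
      (simp_all add: scaleR_conv_of_real[where 'a = complex] algebra_simps)
  then show ?thesis
    by (simp add: vec_eq_iff matJ_diag diag_mat_mult_nth mult_diag_mat_nth)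
qed

text \<open>
  Summing \<open>[J, A\<^sup>k] = k A\<^sup>k\<close> against \<open>x\<^sup>k / k!\<close> turns the commutator with \<open>J\<close> into the Euler operator
  \<open>x d/dx\<close> applied to the exponential.
\<close>

lemma matJ_mat_exp_matA:
  "matJ ** mat_exp (x *\<^sub>R matA a) =
     mat_exp (x *\<^sub>R matA a) ** matJ +
     x *\<^sub>R (matA a ** mat_exp (x *\<^sub>R matA a :: 'n::{finite,linorder} cmat))"
proof -
  let ?A = "matA a :: 'n cmat" and ?N = "CARD('n)"
  have "x *\<^sub>R (?A ** mat_exp (x *\<^sub>R ?A)) = (\<Sum>k<?N. (x ^ Suc k / fact k) *\<^sub>R mpow ?A (Suc k))"
    by (simp add: mat_exp_nilpotent[OF matA_nilpotent] mm.sum_right mm.scaleR_right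
        scaleR_sum_right)
  also have "\<dots> = (\<Sum>k<Suc ?N. (x ^ k / fact k) *\<^sub>R real k *\<^sub>R mpow ?A k)"
    by (subst sum.lessThan_Suc_shift) (auto intro!: sum.cong simp del: of_nat_Suc)
  also have "\<dots> = (\<Sum>k<?N. (x ^ k / fact k) *\<^sub>R real k *\<^sub>R mpow ?A k)"
    by (simp add: matA_nilpotent)
  finally show ?thesis
    by (simp add: mat_exp_nilpotent[OF matA_nilpotent] mm.sum_right mm.sum_left mm.scaleR_right
        mm.scaleR_left matJ_mpow_matA scaleR_add_right sum.distrib del: funpow.simps)
qed

section \<open>Matrix polynomials around a weight\<close>

lemma mpoly_eval_mult: "mpoly_eval (P ** Q) x = mpoly_eval P x ** mpoly_eval Q x"
  by (simp add: mpoly_eval_def matrix_matrix_mult_def poly_sum vec_eq_iff)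

lemma mpoly_eval_add: "mpoly_eval (P + Q) x = mpoly_eval P x + mpoly_eval Q x"
  by (simp add: mpoly_eval_def vec_eq_iff)

lemma has_vector_derivative_mpoly_eval:
  "(mpoly_eval P has_vector_derivative mpoly_eval (mpoly_deriv P) x) (at x)"
proof (rule has_vector_derivative_mat)
  fix i j
  have "((\<lambda>t. poly (P $ i $ j) (complex_of_real t)) has_vector_derivative
          poly (pderiv (P $ i $ j)) (of_real x)) (at x)"
    by (intro has_vector_derivative_real_field poly_DERIV)
  then show "((\<lambda>t. mpoly_eval P t $ i $ j) has_vector_derivative
      mpoly_eval (mpoly_deriv P) x $ i $ j) (at x)"
    by (simp add: mpoly_eval_def mpoly_deriv_def)
qed

lemma mpoly_eval_expand:
  obtains n C where "\<And>x. mpoly_eval P x = (\<Sum>m\<le>n. x ^ m *\<^sub>R C m)"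
proof
  fix x
  let ?n = "\<Sum>i\<in>UNIV. \<Sum>j\<in>UNIV. degree (P $ i $ j)"
  have "poly (P $ i $ j) (of_real x) = (\<Sum>m\<le>?n. coeff (P $ i $ j) m * of_real x ^ m)" for i j
  proof -
    have "degree (P $ i $ j) \<le> (\<Sum>j\<in>UNIV. degree (P $ i $ j))"
      by (rule member_le_sum) auto
    also have "\<dots> \<le> ?n"
      by (rule member_le_sum) auto
    finally show ?thesis
      unfolding poly_altdef by (intro sum.mono_neutral_left) (auto simp: coeff_eq_0)
  qed
  then show "mpoly_eval P x = (\<Sum>m\<le>?n. x ^ m *\<^sub>R (\<chi> i j. coeff (P $ i $ j) m))"
    by (simp add: mpoly_eval_def vec_eq_iff scaleR_conv_of_real[where 'a = complex] mult.commute)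
qed

text \<open>
  Matrix polynomials on both sides of \<open>W\<close> reduce to the scalar monomials \<open>x\<^sup>m W\<close> with constant
  matrices around them.  In this form the moment hypothesis and the boundary hypotheses apply to
  expressions with a polynomial on the left of \<open>W\<close> as well.
\<close>

lemma mpoly_sandwich_expand:
  obtains p q and C D :: "nat \<Rightarrow> 'n::finite cmat" where
    "\<And>(W :: 'n cmat) x. mpoly_eval P x ** W ** adj (mpoly_eval Q x) =
       (\<Sum>m\<le>p. \<Sum>l\<le>q. C m ** (x ^ (m + l) *\<^sub>R W) ** D l)"
proof -
  obtain p C where P: "\<And>x. mpoly_eval P x = (\<Sum>m\<le>p. x ^ m *\<^sub>R C m)"
    using mpoly_eval_expand by blast
  obtain q D where Q: "\<And>x. mpoly_eval Q x = (\<Sum>l\<le>q. x ^ l *\<^sub>R D l)"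
    using mpoly_eval_expand by blast
  show thesis
  proof (rule that)
    fix W :: "'n cmat" and x
    show "mpoly_eval P x ** W ** adj (mpoly_eval Q x) =
       (\<Sum>m\<le>p. \<Sum>l\<le>q. C m ** (x ^ (m + l) *\<^sub>R W) ** adj (D l))"
      unfolding P Q
      by (simp add: mm.sum_left mm.sum_right mm.scaleR_left mm.scaleR_right adj_sum adj_scaleR
          power_add scaleR_sum_right mult.commute, subst sum.swap, simp add: mult.commute)
  qed
qed

lemma mpoly_sandwich_integrable:
  fixes W :: "real \<Rightarrow> 'n::finite cmat"
  assumes "\<And>m. (\<lambda>x. x ^ m *\<^sub>R W x) integrable_on S"
  shows "(\<lambda>x. mpoly_eval P x ** W x ** adj (mpoly_eval Q x)) integrable_on S"
proof -
  obtain p q and C D :: "nat \<Rightarrow> 'n cmat" where *: "\<And>(W :: 'n cmat) x. mpoly_eval P x ** W ** adj (mpoly_eval Q x) =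
       (\<Sum>m\<le>p. \<Sum>l\<le>q. C m ** (x ^ (m + l) *\<^sub>R W) ** D l)"
    by (rule mpoly_sandwich_expand[where P = P and Q = Q], rule that)
  have "(\<lambda>x. C m ** (x ^ (m + l) *\<^sub>R W x) ** D l) integrable_on S" for m l
  proof -
    have "bounded_linear (\<lambda>X. C m ** X ** D l)"
      by (rule bounded_linear_compose[OF mm.bounded_linear_left mm.bounded_linear_right])
    from integrable_linear[OF assms[of "m + l"] this] show ?thesis
      by (simp only: o_def)
  qed
  then show ?thesis
    unfolding * by (intro integrable_sum finite_atMost)
qed

lemma mpoly_sandwich_tendsto_0:
  fixes W :: "real \<Rightarrow> 'n::finite cmat"
  assumes "\<And>m. ((\<lambda>x. x ^ m *\<^sub>R W x) \<longlongrightarrow> 0) F"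
  shows "((\<lambda>x. x *\<^sub>R (mpoly_eval P x ** W x ** adj (mpoly_eval Q x))) \<longlongrightarrow> 0) F"
proof -
  obtain p q and C D :: "nat \<Rightarrow> 'n cmat" where *: "\<And>(W :: 'n cmat) x. mpoly_eval P x ** W ** adj (mpoly_eval Q x) =
       (\<Sum>m\<le>p. \<Sum>l\<le>q. C m ** (x ^ (m + l) *\<^sub>R W) ** D l)"
    by (rule mpoly_sandwich_expand[where P = P and Q = Q], rule that)
  have eq: "x *\<^sub>R (mpoly_eval P x ** W x ** adj (mpoly_eval Q x)) =
      (\<Sum>m\<le>p. \<Sum>l\<le>q. C m ** (x ^ Suc (m + l) *\<^sub>R W x) ** D l)" for x
    by (simp only: *[of x "W x"] scaleR_sum_right mm.scaleR_left mm.scaleR_right scaleR_scaleR power_Suc)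
  show ?thesis
    unfolding eq
    by (intro tendsto_null_sum mm.tendsto_left_zero mm.tendsto_right_zero assms)
qed

section \<open>The Pearson equation\<close>

lemma weightT_diag:
  "weightT \<nu> \<delta> \<phi> x = (diag_mat (\<lambda>i. exp (- \<phi> (of_real x)) *
      of_real (\<delta> (pos i) * x powr (\<nu> + real (pos i)))) :: 'n::{finite,linorder} cmat)"
proof -
  have "(\<Sum>k = 1..CARD('n). (\<delta> k * x powr (\<nu> + real k)) *\<^sub>R (matrix_unit k k :: 'n cmat)) =
      diag_mat (\<lambda>i. of_real (\<delta> (pos i) * x powr (\<nu> + real (pos i))))" (is "?S = ?D")
  proof -
    have "?S $ i $ j = ?D $ i $ j" for i j
    proof -
      have "?S $ i $ j = (\<Sum>k = 1..CARD('n). if pos i = k then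
          (if i = j then of_real (\<delta> (pos i) * x powr (\<nu> + real (pos i))) else 0) else 0)"
        unfolding sum_component
        by (intro sum.cong)
          (auto simp: matrix_unit_def pos_eq_iff scaleR_conv_of_real[where 'a = complex])
      also have "\<dots> = ?D $ i $ j"
        using pos_bounds[of i] by simp
      finally show ?thesis .
    qed
    then show ?thesis by (simp add: vec_eq_iff)
  qed
  moreover have "mat c = (diag_mat (\<lambda>_. c) :: 'n cmat)" for c
    by (simp add: mat_def diag_mat_def)
  ultimately show ?thesis
    by (simp only: weightT_def) (simp add: vec_eq_iff diag_mat_mult_nth)
qed

text \<open>
  A function that is real on the half-line has a real derivative there, as its imaginary part
  vanishes identically.  This is what makes the coefficients of \<open>D\<^sup>\<dagger>\<close> self-adjoint.
\<close>

lemma analytic_real_axis: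
  assumes "\<phi> analytic_on (complex_of_real ` {0..})" "x > 0"
    and real_valued: "\<forall>x\<ge>0. \<phi> (complex_of_real x) \<in> \<real>"
  shows has_vector_derivative_analytic:
      "((\<lambda>x. \<phi> (of_real x)) has_vector_derivative deriv \<phi> (of_real x)) (at x)"
    and deriv_analytic_real: "deriv \<phi> (of_real x) \<in> \<real>"
proof -
  have "\<phi> field_differentiable (at (of_real x))"
    using assms by (intro analytic_on_imp_differentiable_at[of \<phi> "complex_of_real ` {0..}"]) auto
  then show d: "((\<lambda>x. \<phi> (of_real x)) has_vector_derivative deriv \<phi> (of_real x)) (at x)"
    by (intro has_vector_derivative_real_field) (simp add: field_differentiable_derivI)
  have "((\<lambda>x. Im (\<phi> (of_real x))) has_vector_derivative Im (deriv \<phi> (of_real x))) (at x)"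
    by (rule bounded_linear.has_vector_derivative[OF bounded_linear_Im d])
  moreover have "((\<lambda>x. Im (\<phi> (of_real x))) has_vector_derivative 0) (at x)"
  proof (rule has_vector_derivative_transform_within_open[where S = "{0<..}" and f = "\<lambda>_. 0"])
    show "\<And>y. y \<in> {0<..} \<Longrightarrow> 0 = Im (\<phi> (of_real y))"
      using real_valued by (auto simp: complex_is_Real_iff)
  qed (use \<open>x > 0\<close> in auto)
  ultimately have "Im (deriv \<phi> (of_real x)) = 0"
    by (rule vector_derivative_unique_at)
  then show "deriv \<phi> (of_real x) \<in> \<real>"
    by (simp add: complex_is_Real_iff)
qed

text \<open>The logarithmic derivative \<open>x T\<^sup>-\<^sup>1 T'\<close> of the diagonal factor \<open>T\<close> of the weight.\<close>

definition pearson_coeff :: "real \<Rightarrow> (complex \<Rightarrow> complex) \<Rightarrow> real \<Rightarrow> 'n::{finite,linorder} cmat" where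
  "pearson_coeff \<nu> \<phi> x = matJ + mat (of_real \<nu> - of_real x * deriv \<phi> (of_real x))"

lemma has_vector_derivative_weightT:
  assumes phi: "((\<lambda>x. \<phi> (of_real x)) has_vector_derivative deriv \<phi> (of_real x)) (at x)"
    and x: "x > 0"
  shows "(weightT \<nu> \<delta> \<phi> has_vector_derivative
           (1 / x) *\<^sub>R (weightT \<nu> \<delta> \<phi> x ** pearson_coeff \<nu> \<phi> x :: 'n::{finite,linorder} cmat)) (at x)"
proof (rule has_vector_derivative_mat)
  fix i j :: 'n
  define s where "s = \<nu> + real (pos i)"
  define d where "d = \<delta> (pos i)"
  have K: "pearson_coeff \<nu> \<phi> x =
      (diag_mat (\<lambda>i. of_real (\<nu> + real (pos i)) - of_real x * deriv \<phi> (of_real x)) :: 'n cmat)"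
    by (simp add: pearson_coeff_def matJ_diag vec_eq_iff mat_def)
  have e: "((\<lambda>x. exp (- \<phi> (of_real x))) has_vector_derivative
          - deriv \<phi> (of_real x) * exp (- \<phi> (of_real x))) (at x)"
    using field_vector_diff_chain_at[OF has_vector_derivative_minus[OF phi] DERIV_exp]
    by (simp add: o_def)
  have p: "((\<lambda>x. complex_of_real (d * x powr s)) has_vector_derivative
          of_real (d * (s * x powr (s - 1)))) (at x)"
    using x by (intro has_vector_derivative_of_real)
      (auto simp: has_real_derivative_iff_has_vector_derivative[symmetric]
        intro!: derivative_eq_intros)
  have "((\<lambda>x. exp (- \<phi> (of_real x)) * of_real (d * x powr s)) has_vector_derivative
      (1 / x) *\<^sub>R (exp (- \<phi> (of_real x)) * of_real (d * x powr s) *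
         (of_real s - of_real x * deriv \<phi> (of_real x)))) (at x)"
    by (rule has_vector_derivative_eq_rhs[OF has_vector_derivative_mult[OF e p]])
      (use x in \<open>simp add: powr_diff scaleR_conv_of_real field_simps\<close>)
  then show "((\<lambda>t. weightT \<nu> \<delta> \<phi> t $ i $ j) has_vector_derivative
      ((1 / x) *\<^sub>R (weightT \<nu> \<delta> \<phi> x ** pearson_coeff \<nu> \<phi> x)) $ i $ j) (at x)"
    unfolding K by (cases "i = j") (simp_all add: weightT_diag mult_diag_mat_nth s_def d_def)
qed

text \<open>
  The product rule gives \<open>x W' = x A W + E T (K E\<^sup>* + x E\<^sup>* A\<^sup>*)\<close> with \<open>E = e\<^sup>x\<^sup>A\<close>.  The adjoint of
  \<open>[J, E] = x A E\<close> says that the bracket is \<open>E\<^sup>* K\<close>, so the last summand is \<open>W K\<close>.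
\<close>

lemma weightW_pearson:
  assumes phi: "((\<lambda>x. \<phi> (of_real x)) has_vector_derivative deriv \<phi> (of_real x)) (at x)"
    and x: "x > 0"
  obtains W' :: "'n::{finite,linorder} cmat" where
    "(weightW \<nu> a \<delta> \<phi> has_vector_derivative W') (at x)"
    "x *\<^sub>R W' = x *\<^sub>R (matA a ** weightW \<nu> a \<delta> \<phi> x) + weightW \<nu> a \<delta> \<phi> x ** pearson_coeff \<nu> \<phi> x"
proof
  let ?A = "matA a :: 'n cmat"
  let ?E = "\<lambda>x. mat_exp (x *\<^sub>R ?A)"
  let ?T = "weightT \<nu> \<delta> \<phi> :: real \<Rightarrow> 'n cmat"
  let ?K = "pearson_coeff \<nu> \<phi> x :: 'n cmat"
  define W' where "W' = ?E x ** ?T x ** adj (?A ** ?E x) +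
      (?E x ** ((1 / x) *\<^sub>R (?T x ** ?K)) + ?A ** ?E x ** ?T x) ** adj (?E x)"
  have W: "weightW \<nu> a \<delta> \<phi> = (\<lambda>x. ?E x ** ?T x ** adj (?E x))"
    by (simp add: weightW_def fun_eq_iff adj_mat_exp_nilpotent[OF matA_nilpotent])
  have E': "(?E has_vector_derivative ?A ** ?E x) (at x)"
    by (rule has_vector_derivative_mat_exp_nilpotent[OF matA_nilpotent])
  show "(weightW \<nu> a \<delta> \<phi> has_vector_derivative W') (at x)"
    unfolding W W'_def
    by (intro mm.has_vector_derivative E' has_vector_derivative_weightT[OF phi x]
        bounded_linear.has_vector_derivative[OF bounded_linear_adj])
  have J: "adj matJ = (matJ :: 'n cmat)"
    by (simp add: matJ_diag adj_def vec_eq_iff)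
  have "adj (matJ ** ?E x) = adj (?E x ** matJ + x *\<^sub>R (?A ** ?E x))"
    by (simp only: matJ_mat_exp_matA)
  then have "adj (?E x) ** matJ = matJ ** adj (?E x) + x *\<^sub>R adj (?A ** ?E x)"
    by (simp add: adj_add adj_scaleR adj_mult J)
  moreover have "mat c ** M = M ** mat c" for c and M :: "'n cmat"
    by (simp add: matrix_matrix_mult_def mat_def vec_eq_iff if_distrib[of "\<lambda>z. z * _"]
        if_distrib[of "\<lambda>z. _ * z"] mult.commute cong: if_cong)
  ultimately have K: "adj (?E x) ** ?K = ?K ** adj (?E x) + x *\<^sub>R adj (?A ** ?E x)"
    by (simp add: pearson_coeff_def mm.add_left mm.add_right)
  show "x *\<^sub>R W' = x *\<^sub>R (?A ** weightW \<nu> a \<delta> \<phi> x) + weightW \<nu> a \<delta> \<phi> x ** ?K"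
    unfolding W W'_def matrix_mul_assoc[symmetric] K
    using x by (simp add: mm.add_left mm.add_right mm.scaleR_left mm.scaleR_right
        scaleR_add_right matrix_mul_assoc)
qed

section \<open>The two operators and the boundary form\<close>

lemma diff_op_act_opD:
  "diff_op_act P (opD a) x =
     x *\<^sub>R (mpoly_eval P x ** matA a - mpoly_eval P x + mpoly_eval (mpoly_deriv P) x)"
  by (simp add: diff_op_act_def opD_def lessThan_Suc mat_of_real mm.scaleR_right mm.diff_right
      scaleR_add_right add.commute)

text \<open>
  The coefficients of \<open>D\<close> are polynomial, so the moments alone make the integrand of
  \<open>\<langle>P \<cdot> D, Q\<rangle>\<close> integrable.
\<close>

lemma diff_op_act_opD_mpoly:
  fixes P :: "'n::{finite,linorder} mpoly"
  obtains P' :: "'n mpoly" where "diff_op_act P (opD a) = mpoly_eval P'"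
proof
  let ?X = "\<lambda>M :: 'n cmat. (\<chi> i j. [:0, M $ i $ j:]) :: 'n mpoly"
  have X: "mpoly_eval (?X M) x = x *\<^sub>R M" for M x
    by (simp add: mpoly_eval_def vec_eq_iff scaleR_conv_of_real[where 'a = complex])
  show "diff_op_act P (opD a) =
      mpoly_eval (P ** ?X (matA a - mat 1) + mpoly_deriv P ** ?X (mat 1))"
    unfolding fun_eq_iff diff_op_act_opD mpoly_eval_add mpoly_eval_mult X
    by (simp add: mm.scaleR_right mm.diff_right scaleR_add_right)
qed

lemma diff_op_act_opD_dagger:
  "diff_op_act Q (opD_dagger \<nu> \<phi>) x =
     - (mpoly_eval Q x ** pearson_coeff \<nu> \<phi> x + (1 + x) *\<^sub>R mpoly_eval Q x
        + x *\<^sub>R mpoly_eval (mpoly_deriv Q) x)"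
proof -
  have coeff: "- (mat (of_real (1 + \<nu>)) + matJ) + mat (of_real x * deriv \<phi> (of_real x)) -
        mat (of_real x) = - (pearson_coeff \<nu> \<phi> x + (1 + x) *\<^sub>R (mat 1 :: 'a cmat))" for x
    by (simp add: pearson_coeff_def vec_eq_iff mat_def scaleR_conv_of_real[where 'a = complex])
  show ?thesis
    unfolding diff_op_act_def opD_dagger_def coeff
    by (simp add: lessThan_Suc mm.minus_right mm.add_right mm.diff_right mm.scaleR_right mat_of_real)
qed

lemma adj_pearson_coeff:
  assumes "deriv \<phi> (of_real x) \<in> \<real>"
  shows "adj (pearson_coeff \<nu> \<phi> x) = pearson_coeff \<nu> \<phi> x"
  using assms by (auto simp: pearson_coeff_def matJ_diag adj_def mat_def vec_eq_iff elim!: Reals_cases)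

text \<open>
  Testing the boundary condition on the scalar polynomials \<open>x\<^sup>m\<close> loses nothing, by
  \<open>mpoly_sandwich_tendsto_0\<close>.
\<close>

lemma boundary_moment:
  fixes W :: "real \<Rightarrow> 'n::finite cmat"
  assumes "\<forall>R. ((\<lambda>x. W x ** mpoly_eval R x) \<longlongrightarrow> 0) F"
  shows "((\<lambda>x. x ^ m *\<^sub>R W x) \<longlongrightarrow> 0) F"
proof -
  let ?R = "\<chi> i j. if i = j then monom 1 m else 0 :: 'n mpoly"
  have "mpoly_eval ?R x = x ^ m *\<^sub>R mat 1" for x
    by (simp add: mpoly_eval_def vec_eq_iff mat_def poly_monom scaleR_conv_of_real[where 'a = complex])
  then show ?thesis
    using spec[OF assms, of ?R] by (simp add: mm.scaleR_right)
qed

lemma has_vector_derivative_boundary_form: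
  fixes P Q :: "'n::{finite,linorder} mpoly"
  assumes W: "(W has_vector_derivative W') (at x)"
    and pearson: "x *\<^sub>R W' = x *\<^sub>R (matA a ** W x) + W x ** pearson_coeff \<nu> \<phi> x"
    and real: "deriv \<phi> (of_real x) \<in> \<real>"
  shows "((\<lambda>x. x *\<^sub>R (mpoly_eval P x ** W x ** adj (mpoly_eval Q x))) has_vector_derivative
           inner_integrand W (diff_op_act P (opD a)) (mpoly_eval Q) x -
           inner_integrand W (mpoly_eval P) (diff_op_act Q (opD_dagger \<nu> \<phi>)) x) (at x)"
proof -
  let ?p = "mpoly_eval P x" and ?p' = "mpoly_eval (mpoly_deriv P) x"
  let ?q = "adj (mpoly_eval Q x)" and ?q' = "adj (mpoly_eval (mpoly_deriv Q) x)"
  let ?K = "pearson_coeff \<nu> \<phi> x :: 'n cmat"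
  have "((\<lambda>x. x *\<^sub>R (mpoly_eval P x ** W x ** adj (mpoly_eval Q x))) has_vector_derivative
      x *\<^sub>R (?p ** W x ** ?q' + (?p ** W' + ?p' ** W x) ** ?q) + 1 *\<^sub>R (?p ** W x ** ?q)) (at x)"
    by (intro has_vector_derivative_scaleR mm.has_vector_derivative W DERIV_ident
        has_vector_derivative_mpoly_eval
        bounded_linear.has_vector_derivative[OF bounded_linear_adj])
  moreover have "x *\<^sub>R (?p ** W' ** ?q) = x *\<^sub>R (?p ** matA a ** W x ** ?q) + ?p ** W x ** ?K ** ?q"
  proof -
    have "x *\<^sub>R (?p ** W' ** ?q) = ?p ** (x *\<^sub>R W') ** ?q"
      by (simp add: mm.scaleR_left mm.scaleR_right)
    then show ?thesis
      by (simp add: pearson mm.scaleR_left mm.scaleR_right mm.add_left mm.add_right matrix_mul_assoc)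
  qed
  moreover have adj_dagger: "adj (diff_op_act Q (opD_dagger \<nu> \<phi>) x) = - (?K ** ?q + (1 + x) *\<^sub>R ?q + x *\<^sub>R ?q')"
    by (simp add: diff_op_act_opD_dagger adj_minus adj_add adj_scaleR adj_mult adj_pearson_coeff[OF real]
        del: minus_add_distrib)
  ultimately show ?thesis
    unfolding inner_integrand_def diff_op_act_opD adj_dagger
    by (simp add: mm.add_left mm.add_right mm.diff_left mm.diff_right mm.minus_right mm.scaleR_left
        mm.scaleR_right matrix_mul_assoc algebra_simps)
qed

theorem proposition3p1:
  fixes \<nu> :: real and a \<delta> :: "nat \<Rightarrow> real" and \<phi> :: "complex \<Rightarrow> complex"
    and W :: "real \<Rightarrow> 'n::{finite,linorder} cmat"
  defines "W \<equiv> weightW \<nu> a \<delta> \<phi>"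
  assumes nu: "\<nu> > 0"
    and delta: "\<forall>k\<in>{1..CARD('n)}. \<delta> k > 0"
    and analytic: "\<phi> analytic_on (complex_of_real ` {0..})"
    and real_valued: "\<forall>x\<ge>0. \<phi> (complex_of_real x) \<in> \<real>"
    and moments: "\<forall>m. (\<lambda>x. x ^ m *\<^sub>R W x) integrable_on {0..}"
    and boundary_0: "\<forall>R. ((\<lambda>x. W x ** mpoly_eval R x) \<longlongrightarrow> 0) (at_right 0)"
    and boundary_inf: "\<forall>R. ((\<lambda>x. W x ** mpoly_eval R x) \<longlongrightarrow> 0) at_top"
  shows "\<forall>P Q :: 'n mpoly.
    inner_integrand W (diff_op_act P (opD a)) (mpoly_eval Q) integrable_on {0..} \<and>
    inner_integrand W (mpoly_eval P) (diff_op_act Q (opD_dagger \<nu> \<phi>)) integrable_on {0..} \<and>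
    mat_inner W (diff_op_act P (opD a)) (mpoly_eval Q) =
      mat_inner W (mpoly_eval P) (diff_op_act Q (opD_dagger \<nu> \<phi>))"
proof (intro allI)
  fix P Q :: "'n mpoly"
  let ?f = "inner_integrand W (diff_op_act P (opD a)) (mpoly_eval Q)"
  let ?g = "inner_integrand W (mpoly_eval P) (diff_op_act Q (opD_dagger \<nu> \<phi>))"
  let ?H = "\<lambda>x. x *\<^sub>R (mpoly_eval P x ** W x ** adj (mpoly_eval Q x))"
  obtain P' :: "'n mpoly" where "diff_op_act P (opD a) = mpoly_eval P'"
    by (rule diff_op_act_opD_mpoly)
  then have f: "?f integrable_on {0..}"
    using mpoly_sandwich_integrable[of W "{0..}" P' Q] moments
    by (simp add: inner_integrand_def[abs_def])
  have H': "(?H has_vector_derivative ?f x - ?g x) (at x)" if "x > 0" for x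
  proof -
    note x = that
    note phi = has_vector_derivative_analytic[OF analytic x real_valued]
    obtain W' where "(W has_vector_derivative W') (at x)"
      "x *\<^sub>R W' = x *\<^sub>R (matA a ** W x) + W x ** pearson_coeff \<nu> \<phi> x"
      unfolding W_def
      by (rule weightW_pearson[OF phi x, where \<nu> = \<nu> and a = a and \<delta> = \<delta>])
    then show ?thesis
      by (rule has_vector_derivative_boundary_form)
        (rule deriv_analytic_real[OF analytic x real_valued])
  qed
  \<comment> \<open>The factor \<open>x\<close> makes \<open>?H 0\<close> equal to \<open>0\<close> whatever the value of \<open>W 0\<close> is.\<close>
  have "(?H \<longlongrightarrow> 0) (at_right 0)"
    by (intro mpoly_sandwich_tendsto_0 boundary_moment boundary_0)
  then have H0: "continuous (at 0 within {0..}) ?H"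
    by (simp add: continuous_within at_within_Ici_at_right)
  have H_cont: "continuous_on {0..} ?H"
    unfolding continuous_on_eq_continuous_within
  proof
    fix x :: real assume "x \<in> {0..}"
    then consider "x = 0" | "x > 0" by fastforce
    then show "continuous (at x within {0..}) ?H"
    proof cases
      case 1
      then show ?thesis using H0 by simp
    next
      case 2
      show ?thesis
        by (rule has_vector_derivative_continuous[OF has_vector_derivative_at_within[OF H'[OF 2]]])
    qed
  qed
  have H_inf: "(?H \<longlongrightarrow> 0) at_top"
    by (intro mpoly_sandwich_tendsto_0 boundary_moment boundary_inf)
  have "((\<lambda>x. ?f x - ?g x) has_integral 0) {0..}"
    using has_integral_improper_FTC[OF H_cont H' H_inf] by simp
  from has_integral_diff[OF integrable_integral[OF f] this]
  have "(?g has_integral integral {0..} ?f) {0..}"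
    by simp
  then show "?f integrable_on {0..} \<and> ?g integrable_on {0..} \<and>
      mat_inner W (diff_op_act P (opD a)) (mpoly_eval Q) =
      mat_inner W (mpoly_eval P) (diff_op_act Q (opD_dagger \<nu> \<phi>))"
    using f by (auto simp: mat_inner_def integral_unique has_integral_integrable)
qed

end
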